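(* Let $\gamma_1$ be the One Gaussian Norm on $\mathbb{R}^2$, $\gamma_1(x,y)=\int_{-\infty}^{\infty}|xt-y|e^{-t^2}\,dt$, let $B_1=\{(x,y)\in\mathbb{R}^2:\gamma_1(x,y)\le 1\}$ be its unit ball, and let $h$ be the support function of $B_1$. For $z\in\mathbb{R}$ let $\Phi(z)=2\int_0^z e^{-s^2}\,ds$ and $G(z)=e^{z^2}\Phi(z)$, and let $G^{-1}$ be the inverse function of $G:\mathbb{R}\to\mathbb{R}$. Then $$h(\cos\theta,\sin\theta)=\cos\theta\,\exp\big((G^{-1}(\tan\theta))^2\big),\qquad -\frac{\pi}{2}<\theta<\frac{\pi}{2},$$ and $$h(0,1)=\lim_{\theta\uparrow\pi/2}h(\cos\theta,\sin\theta)=\frac{1}{\sqrt{\pi}},\qquad h(0,-1)=\lim_{\theta\downarrow-\pi/2}h(\cos\theta,\sin\theta)=\frac{1}{\sqrt{\pi}}.$$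
   Context: The support function of a compact convex set $K\subset\mathbb{R}^2$ is $h(u)=\max_{p\in K}\langle u,p\rangle$, $u\in\mathbb{R}^2$, where $\langle\cdot,\cdot\rangle$ is the standard inner product. Thus the support function of the unit ball of a norm is the dual norm. *)

theory Defs
  imports "HOL-Analysis.Analysis"
begin

definition gamma1 :: "real \<times> real \<Rightarrow> real" where
  "gamma1 = (\<lambda>(x, y). LINT t|lborel. \<bar>x * t - y\<bar> * exp (- t\<^sup>2))"

definition B1 :: "(real \<times> real) set" where
  "B1 = {p. gamma1 p \<le> 1}"

(* Greatest renders the maximum: it is the value attained on K that bounds all others,
   and is unspecified unless such a value exists (it does for compact nonempty K). *)
definition support_function :: "(real \<times> real) set \<Rightarrow> real \<times> real \<Rightarrow> real" where
  "support_function K u = (GREATEST m. m \<in> (\<lambda>p. u \<bullet> p) ` K)"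

(* The interval integral is oriented, so Phi is odd. *)
definition Phi :: "real \<Rightarrow> real" where
  "Phi z = 2 * (LBINT s=0..z. exp (- s\<^sup>2))"

definition G :: "real \<Rightarrow> real" where
  "G z = exp (z\<^sup>2) * Phi z"

end

theory Submission
  imports Defs "HOL-Probability.Distributions" "HOL-Real_Asymp.Real_Asymp"
begin

text \<open>
  For every measurable \<open>\<sigma>\<close> with values in \<open>[-1, 1]\<close>, \<open>gamma1 (x, y)\<close> is at least the integral of
  \<open>\<sigma> t * (x * t - y) * exp (- t\<^sup>2)\<close>, a linear function of \<open>(x, y)\<close>. The choice
  \<open>\<sigma> t = sgn (t - z)\<close> gives \<open>x + G z * y \<le> exp (z\<^sup>2) * gamma1 (x, y)\<close>, with equality at
  \<open>(1, z)\<close>, so the support function at \<open>(1, G z)\<close> is \<open>exp (z\<^sup>2)\<close>; as \<open>G\<close> is onto, homogeneity gives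
  all directions with \<open>cos \<theta> > 0\<close>. Constant \<open>\<sigma> = \<plusminus>1\<close> settles \<open>(0, \<plusminus>1)\<close>. These bounds also confine
  the unit ball to \<open>x \<le> 1\<close>, \<open>\<bar>y\<bar> \<le> 1 / sqrt pi\<close>, which gives
  \<open>\<bar>sin \<theta>\<bar> / sqrt pi \<le> h (cos \<theta>, sin \<theta>) \<le> cos \<theta> + \<bar>sin \<theta>\<bar> / sqrt pi\<close> and hence the limits.
\<close>

section \<open>Gaussian integrals weighted by a sign\<close>

lemma has_bochner_integral_gaussian:
  "has_bochner_integral lborel (\<lambda>t::real. exp (- t\<^sup>2)) (sqrt pi)"
  using has_bochner_integral_even_function[OF gaussian_moment_0] by simp

lemma has_bochner_integral_times_gaussian:
  "has_bochner_integral lborel (\<lambda>t::real. t * exp (- t\<^sup>2)) 0"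
  using has_bochner_integral_odd_function[OF gaussian_moment_1] by (simp add: mult.commute)

lemmas integrable_gaussian = integrable.intros[OF has_bochner_integral_gaussian]
lemmas integrable_times_gaussian = integrable.intros[OF has_bochner_integral_times_gaussian]

lemma integrable_sgn_mult:
  fixes f :: "real \<Rightarrow> real"
  assumes "integrable lborel f"
  shows "integrable lborel (\<lambda>t. sgn (t - z) * f t)"
proof (rule Bochner_Integration.integrable_bound[OF assms])
  show "(\<lambda>t. sgn (t - z) * f t) \<in> borel_measurable lborel"
    using assms by measurable
qed (auto simp: abs_mult sgn_if)

lemma integral_sgn_mult:
  fixes f :: "real \<Rightarrow> real"
  assumes "integrable lborel f"
  shows "(LBINT t. sgn (t - z) * f t) = (LBINT t=z..\<infinity>. f t) - (LBINT t=-\<infinity>..z. f t)"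
proof -
  have *: "integrable lborel (\<lambda>t. indicator A t * f t)" if "A \<in> sets borel" for A :: "real set"
    using integrable_mult_indicator[OF _ assms, of A] that by simp
  \<comment> \<open>This holds at \<open>t = z\<close> too: both half-lines are open and
    \<open>sgn 0 = 0\<close>.\<close>
  have "sgn (t - z) * f t = indicator {z<..} t * f t - indicator {..<z} t * f t" for t
    by (auto simp: sgn_if indicator_def)
  then show ?thesis
    by (simp add: interval_lebesgue_integral_def set_lebesgue_integral_def *
        Bochner_Integration.integral_diff)
qed

text \<open>The antiderivative \<open>- exp (- t\<^sup>2) / 2\<close> vanishes at both infinities,
  so each side of \<open>z\<close> contributes half of \<open>exp (- z\<^sup>2)\<close>.\<close>

lemma integral_sgn_times_gaussian:
  fixes z :: real
  shows "(LBINT t. sgn (t - z) * (t * exp (- t\<^sup>2))) = exp (- z\<^sup>2)"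
proof -
  let ?f = "\<lambda>t::real. t * exp (- t\<^sup>2)" and ?F = "\<lambda>t::real. - exp (- t\<^sup>2) / 2"
  have deriv: "(?F has_vector_derivative ?f t) (at t)" for t
    by (auto intro!: derivative_eq_intros simp flip: has_real_derivative_iff_has_vector_derivative)
  have int: "set_integrable lborel A ?f" if "A \<in> sets borel" for A :: "real set"
    using integrable_mult_indicator[OF _ integrable_times_gaussian, of A] that
    by (simp add: set_integrable_def)
  have lim: "((?F \<circ> real_of_ereal) \<longlongrightarrow> ?F z) (at_right (ereal z))"
            "((?F \<circ> real_of_ereal) \<longlongrightarrow> ?F z) (at_left (ereal z))"
    unfolding ereal_tendsto_simps by (auto intro!: tendsto_eq_intros)
  have inf: "((?F \<circ> real_of_ereal) \<longlongrightarrow> 0) (at_left \<infinity>)" "((?F \<circ> real_of_ereal) \<longlongrightarrow> 0) (at_right (-\<infinity>))"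
    unfolding ereal_tendsto_simps by real_asymp+
  have cont: "isCont ?f t" for t
    by (intro continuous_intros)
  have "(LBINT t=z..\<infinity>. ?f t) = 0 - ?F z"
    by (rule interval_integral_FTC_integrable[OF _ deriv cont int lim(1) inf(1)]) auto
  moreover have "(LBINT t=-\<infinity>..z. ?f t) = ?F z - 0"
    by (rule interval_integral_FTC_integrable[OF _ deriv cont int inf(2) lim(2)]) auto
  ultimately show ?thesis
    unfolding integral_sgn_mult[OF integrable_times_gaussian] by simp
qed

text \<open>Splitting both half-lines at 0, the two infinite pieces cancel by evenness, and the
  piece from 0 to \<open>z\<close> is subtracted twice.\<close>

lemma integral_sgn_gaussian:
  "(LBINT t. sgn (t - z) * exp (- t\<^sup>2)) = - Phi z"
proof -
  let ?I = "\<lambda>a b. LBINT t=a..b. exp (- t\<^sup>2)"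
  have int: "set_integrable lborel A (\<lambda>t. exp (- t\<^sup>2))" if "A \<in> sets borel" for A :: "real set"
    using integrable_mult_indicator[OF _ integrable_gaussian, of A] that
    by (simp add: set_integrable_def)
  have sum: "?I a b + ?I b c = ?I a c" for a b c :: ereal
    by (intro interval_integral_sum) (auto simp: interval_lebesgue_integrable_def int)
  have "?I (-\<infinity>) 0 = ?I 0 \<infinity>"
    by (subst interval_integral_reflect) simp
  then show ?thesis
    using sum[of "-\<infinity>" 0 z] sum[of 0 z \<infinity>]
    by (simp add: integral_sgn_mult[OF integrable_gaussian] Phi_def)
qed

section \<open>Lower bounds for the norm and their equality cases\<close>

lemma integrable_gamma1:
  fixes x y :: real
  shows "integrable lborel (\<lambda>t. \<bar>x * t - y\<bar> * exp (- t\<^sup>2))"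
proof -
  have "integrable lborel (\<lambda>t. \<bar>x * (t * exp (- t\<^sup>2)) - y * exp (- t\<^sup>2)\<bar>)"
    by (intro Bochner_Integration.integrable_abs Bochner_Integration.integrable_diff
        integrable_mult_right integrable_gaussian integrable_times_gaussian)
  moreover have "\<bar>x * (t * exp (- t\<^sup>2)) - y * exp (- t\<^sup>2)\<bar> = \<bar>(x * t - y) * exp (- t\<^sup>2)\<bar>" for t
    by (simp only: left_diff_distrib mult.assoc)
  ultimately show ?thesis by (simp add: abs_mult)
qed

lemma sgn_linear_gaussian:
  shows "integrable lborel (\<lambda>t. sgn (t - z) * ((x * t - y) * exp (- t\<^sup>2)))"
  "(LBINT t. sgn (t - z) * ((x * t - y) * exp (- t\<^sup>2))) = x * exp (- z\<^sup>2) + y * Phi z"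
proof -
  have *: "sgn (t - z) * ((x * t - y) * exp (- t\<^sup>2)) =
    x * (sgn (t - z) * (t * exp (- t\<^sup>2))) - y * (sgn (t - z) * exp (- t\<^sup>2))" for t
    by (simp add: algebra_simps)
  note i = integrable_sgn_mult[OF integrable_gaussian] integrable_sgn_mult[OF integrable_times_gaussian]
  show "integrable lborel (\<lambda>t. sgn (t - z) * ((x * t - y) * exp (- t\<^sup>2)))"
    unfolding * using i by auto
  show "(LBINT t. sgn (t - z) * ((x * t - y) * exp (- t\<^sup>2))) = x * exp (- z\<^sup>2) + y * Phi z"
    unfolding * using i by (simp add: integral_sgn_times_gaussian integral_sgn_gaussian)
qed

lemma gamma1_ge: "x + G z * y \<le> exp (z\<^sup>2) * gamma1 (x, y)"
proof -
  have "x * exp (- z\<^sup>2) + y * Phi z \<le> gamma1 (x, y)"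
    unfolding gamma1_def sgn_linear_gaussian(2)[symmetric] prod.case
    by (intro integral_mono sgn_linear_gaussian integrable_gamma1)
      (auto simp: sgn_if abs_if algebra_simps mult_less_0_iff intro: mult_right_mono)
  then have "exp (z\<^sup>2) * (x * exp (- z\<^sup>2) + y * Phi z) \<le> exp (z\<^sup>2) * gamma1 (x, y)"
    by simp
  then show ?thesis
    by (simp add: G_def distrib_left exp_minus mult_ac)
qed

text \<open>Here \<open>t - z\<close> is itself the linear factor, so weighting by its sign produces
  the absolute value and nothing is lost.\<close>

lemma gamma1_eq: "1 + G z * z = exp (z\<^sup>2) * gamma1 (1, z)"
proof -
  have "sgn (t - z) * ((1 * t - z) * exp (- t\<^sup>2)) = \<bar>1 * t - z\<bar> * exp (- t\<^sup>2)" for t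
    by (auto simp: sgn_if)
  then have "gamma1 (1, z) = 1 * exp (- z\<^sup>2) + z * Phi z"
    by (simp only: gamma1_def prod.case flip: sgn_linear_gaussian(2))
  then show ?thesis
    by (simp add: G_def distrib_left exp_minus mult_ac)
qed

text \<open>Without a weight the odd term integrates to 0, leaving \<open>- y * sqrt pi\<close>;
  bounding the absolute value of the integral covers both constant signs at once.\<close>

lemma gamma1_ge_snd: "\<bar>y\<bar> * sqrt pi \<le> gamma1 (x, y)"
proof -
  have eq: "(x * t - y) * exp (- t\<^sup>2) = x * (t * exp (- t\<^sup>2)) - y * exp (- t\<^sup>2)" for t
    by (simp add: algebra_simps)
  have "(LBINT t. (x * t - y) * exp (- t\<^sup>2)) = - y * sqrt pi"
    unfolding eq using integrable_gaussian integrable_times_gaussian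
      has_bochner_integral_gaussian has_bochner_integral_times_gaussian
    by (simp add: has_bochner_integral_iff)
  then have "\<bar>y\<bar> * sqrt pi = \<bar>LBINT t. (x * t - y) * exp (- t\<^sup>2)\<bar>"
    by (simp add: abs_mult)
  also have "\<dots> \<le> gamma1 (x, y)"
    unfolding gamma1_def prod.case
    using integral_abs_bound[of lborel "\<lambda>t. (x * t - y) * exp (- t\<^sup>2)"] by (simp add: abs_mult)
  finally show ?thesis .
qed

lemma gamma1_0_left: "gamma1 (0, y) = \<bar>y\<bar> * sqrt pi"
  using has_bochner_integral_gaussian by (simp add: gamma1_def has_bochner_integral_iff)

lemma gamma1_scale: "c \<ge> 0 \<Longrightarrow> gamma1 (c * x, c * y) = c * gamma1 (x, y)"
  by (simp add: gamma1_def mult.assoc abs_mult flip: right_diff_distrib)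

section \<open>Growth and surjectivity of \<open>G\<close>\<close>

lemma has_real_derivative_Phi: "(Phi has_real_derivative 2 * exp (- z\<^sup>2)) (at z)"
proof -
  \<comment> \<open>This interval has both 0 and \<open>z\<close> in its interior, whatever the sign
    of \<open>z\<close>.\<close>
  have "at z within {-\<bar>z\<bar>-1..\<bar>z\<bar>+1} = at z"
    by (rule at_within_interior) auto
  moreover have "((\<lambda>u. LBINT s=0..u. exp (- s\<^sup>2)) has_vector_derivative exp (- z\<^sup>2)) (at z within {-\<bar>z\<bar>-1..\<bar>z\<bar>+1})"
    unfolding zero_ereal_def by (intro interval_integral_FTC2) (auto intro!: continuous_intros)
  ultimately have "((\<lambda>u. LBINT s=0..u. exp (- s\<^sup>2)) has_real_derivative exp (- z\<^sup>2)) (at z)"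
    by (simp only: has_real_derivative_iff_has_vector_derivative)
  from DERIV_cmult[OF this, of 2] show ?thesis
    by (simp add: Phi_def[abs_def])
qed

lemma Phi_0 [simp]: "Phi 0 = 0"
  by (simp add: Phi_def flip: zero_ereal_def)

lemma G_0 [simp]: "G 0 = 0"
  by (simp add: G_def)

lemma isCont_G: "isCont G z"
proof -
  have "isCont Phi z" by (rule DERIV_isCont[OF has_real_derivative_Phi])
  then show ?thesis unfolding G_def[abs_def] by (intro continuous_intros)
qed

text \<open>By the mean value theorem \<open>Phi z = 2 * z * exp (- w\<^sup>2)\<close> with
  \<open>w\<close> between 0 and \<open>z\<close>; the factor \<open>exp (z\<^sup>2)\<close>
  outweighs \<open>exp (- w\<^sup>2)\<close>.\<close>

lemma G_bounds:
  shows G_ge: "z \<ge> 0 \<Longrightarrow> 2 * z \<le> G z" and G_le: "z \<le> 0 \<Longrightarrow> G z \<le> 2 * z"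
proof -
  have cancel: "exp (z\<^sup>2) * (2 * z * exp (- z\<^sup>2)) = 2 * z"
    by (simp add: exp_minus)
  show "2 * z \<le> G z" if "z \<ge> 0"
  proof (cases "z = 0")
    case False
    with that obtain w where w: "0 < w" "w < z" "Phi z = 2 * z * exp (- w\<^sup>2)"
      using MVT2[of 0 z Phi "\<lambda>w. 2 * exp (- w\<^sup>2)"] has_real_derivative_Phi by auto
    then have "w\<^sup>2 \<le> z\<^sup>2" by (intro power_mono) auto
    with w have "exp (z\<^sup>2) * (2 * z * exp (- z\<^sup>2)) \<le> G z"
      unfolding G_def by (intro mult_left_mono) (auto intro!: mult_left_mono)
    then show ?thesis by (simp only: cancel)
  qed simp
  show "G z \<le> 2 * z" if "z \<le> 0"
  proof (cases "z = 0")
    case False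
    with that obtain w where w: "z < w" "w < 0" "Phi z = 2 * z * exp (- w\<^sup>2)"
      using MVT2[of z 0 Phi "\<lambda>w. 2 * exp (- w\<^sup>2)"] has_real_derivative_Phi by auto
    then have "w\<^sup>2 \<le> z\<^sup>2" by (simp add: abs_le_square_iff[symmetric])
    with w have "G z \<le> exp (z\<^sup>2) * (2 * z * exp (- z\<^sup>2))"
      unfolding G_def by (intro mult_left_mono) (auto intro!: mult_left_mono_neg)
    then show ?thesis by (simp only: cancel)
  qed simp
qed

text \<open>The linear bounds place \<open>y\<close> between \<open>G 0 = 0\<close> and
  \<open>G y\<close>, so the intermediate value theorem applies between 0 and
  \<open>y\<close>.\<close>

lemma surj_G: "surj G"
  unfolding surj_def
proof
  fix y
  have "\<exists>z. G z = y"
  proof (cases "y \<ge> 0")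
    case True
    then show ?thesis
      using IVT[of G 0 y y] isCont_G G_ge[of y] by auto
  next
    case False
    then show ?thesis
      using IVT[of G y y 0] isCont_G G_le[of y] by auto
  qed
  then show "\<exists>z. y = G z" by metis
qed

section \<open>Values of the support function\<close>

lemma support_function_eqI:
  assumes "p \<in> K" "\<And>q. q \<in> K \<Longrightarrow> u \<bullet> q \<le> u \<bullet> p" "u \<bullet> p = m"
  shows "support_function K u = m"
  unfolding support_function_def using assms by (intro Greatest_equality) auto

text \<open>The maximiser is \<open>(1, z)\<close> rescaled to the unit sphere. Attainment and the
  upper bound are recorded separately because the squeeze below uses each of them.\<close>

lemma support_function_B1:
  assumes "c > 0"
  shows "support_function B1 (c, c * G z) = c * exp (z\<^sup>2)" (is "?eq")
    and "\<exists>p\<in>B1. support_function B1 (c, c * G z) = (c, c * G z) \<bullet> p" (is "?attained")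
    and "p \<in> B1 \<Longrightarrow> (c, c * G z) \<bullet> p \<le> support_function B1 (c, c * G z)"
proof -
  have le: "(c, c * G z) \<bullet> q \<le> c * exp (z\<^sup>2)" if "q \<in> B1" for q
  proof (cases q)
    case (Pair x y)
    have "x + G z * y \<le> exp (z\<^sup>2) * gamma1 (x, y)" by (rule gamma1_ge)
    also have "\<dots> \<le> exp (z\<^sup>2)" using that Pair by (simp add: B1_def)
    finally show ?thesis
      using mult_left_mono[of "x + G z * y" "exp (z\<^sup>2)" c] assms Pair by (simp add: algebra_simps)
  qed
  \<comment> \<open>\<open>G z\<close> and \<open>z\<close> never have opposite signs, so
    \<open>1 + G z * z\<close> is positive and \<open>(1, z)\<close> can be normalised.\<close>
  have "G z * z \<ge> 0"
    using G_ge[of z] G_le[of z] by (cases "z \<ge> 0") (auto intro: mult_nonneg_nonneg mult_nonpos_nonpos)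
  then have pos: "gamma1 (1, z) > 0"
    using gamma1_eq[of z] by (smt (verit) exp_gt_zero zero_less_mult_iff)
  define a where "a = 1 / gamma1 (1, z)"
  have mem: "(a, a * z) \<in> B1"
    using gamma1_scale[of a 1 z] pos by (simp add: B1_def a_def)
  have "(c, c * G z) \<bullet> (a, a * z) = c * a * (1 + G z * z)"
    by (simp add: algebra_simps)
  also have "\<dots> = c * exp (z\<^sup>2)"
    unfolding gamma1_eq using pos by (simp add: a_def)
  finally have eq: "(c, c * G z) \<bullet> (a, a * z) = c * exp (z\<^sup>2)" .
  show ?eq
    using le mem eq by (intro support_function_eqI[where p = "(a, a * z)"]) auto
  then show ?attained
    using mem eq by metis
  show "p \<in> B1 \<Longrightarrow> (c, c * G z) \<bullet> p \<le> support_function B1 (c, c * G z)"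
    using le \<open>?eq\<close> by simp
qed

lemma B1_bounds:
  assumes "(x, y) \<in> B1"
  shows "x \<le> 1" "\<bar>y\<bar> \<le> 1 / sqrt pi"
proof -
  \<comment> \<open>This is the sign-weighted bound at \<open>z = 0\<close>, where \<open>G\<close>
    vanishes.\<close>
  show "x \<le> 1"
    using gamma1_ge[of x 0 y] assms by (simp add: B1_def)
  show "\<bar>y\<bar> \<le> 1 / sqrt pi"
    using gamma1_ge_snd[of y x] assms by (simp add: B1_def field_simps)
qed

lemma axis_mem_B1: "\<bar>y\<bar> \<le> 1 / sqrt pi \<Longrightarrow> (0, y) \<in> B1"
  by (simp add: B1_def gamma1_0_left field_simps)

lemma support_function_B1_axis:
  assumes "\<bar>s\<bar> = 1"
  shows "support_function B1 (0, s) = 1 / sqrt pi"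
proof (rule support_function_eqI)
  have s: "s * s = 1" using assms by (metis abs_mult_self_eq mult_1)
  show "(0, s / sqrt pi) \<in> B1"
    using assms by (intro axis_mem_B1) simp
  show "(0, s) \<bullet> (0, s / sqrt pi) = 1 / sqrt pi"
    by (simp add: s)
  fix q assume "q \<in> B1"
  then show "(0, s) \<bullet> q \<le> (0, s) \<bullet> (0, s / sqrt pi)"
    using B1_bounds(2)[of "fst q" "snd q"] assms abs_le_D1[of "s * snd q"]
    by (cases q) (simp add: s abs_mult)
qed

section \<open>Limits at the vertical directions\<close>

lemma support_function_B1_squeeze:
  assumes "c > 0"
  shows "\<bar>s\<bar> / sqrt pi \<le> support_function B1 (c, s)"
    and "support_function B1 (c, s) \<le> c + \<bar>s\<bar> / sqrt pi"
proof -
  obtain z where "G z = s / c"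
    using surj_G by (metis surjD)
  then have s: "s = c * G z" using assms by simp
  \<comment> \<open>Testing against one axis point of the ball gives the lower bound.\<close>
  have "(c, s) \<bullet> (0, sgn s / sqrt pi) \<le> support_function B1 (c, s)"
    unfolding s by (intro support_function_B1 assms axis_mem_B1) (simp add: sgn_if)
  then show "\<bar>s\<bar> / sqrt pi \<le> support_function B1 (c, s)"
    by (simp add: abs_sgn)
  \<comment> \<open>For the upper bound, the two coordinates of a maximiser are estimated
    separately.\<close>
  obtain x y where xy: "(x, y) \<in> B1" "support_function B1 (c, s) = c * x + s * y"
    using support_function_B1(2)[OF assms, of z] unfolding s by auto
  have "c * x \<le> c"
    using B1_bounds(1)[OF xy(1)] assms by simp
  moreover have "s * y \<le> \<bar>s\<bar> * (1 / sqrt pi)"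
    by (metis B1_bounds(2)[OF xy(1)] abs_ge_self abs_ge_zero abs_mult mult_left_mono order_trans)
  ultimately show "support_function B1 (c, s) \<le> c + \<bar>s\<bar> / sqrt pi"
    using xy by simp
qed

text \<open>The general filter and \<open>\<bar>sin \<theta>\<bar>\<close> let one squeeze serve
  both endpoints, where \<open>sin\<close> tends to 1 and to -1.\<close>

lemma tendsto_support_function_B1:
  assumes "((\<lambda>\<theta>. \<bar>sin \<theta>\<bar>) \<longlongrightarrow> 1) F" "(cos \<longlongrightarrow> 0) F" "eventually (\<lambda>\<theta>::real. cos \<theta> > 0) F"
  shows "((\<lambda>\<theta>. support_function B1 (cos \<theta>, sin \<theta>)) \<longlongrightarrow> 1 / sqrt pi) F"
proof (rule tendsto_sandwich)
  show "\<forall>\<^sub>F \<theta> in F. \<bar>sin \<theta>\<bar> / sqrt pi \<le> support_function B1 (cos \<theta>, sin \<theta>)"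
    using assms(3) by eventually_elim (rule support_function_B1_squeeze)
  show "\<forall>\<^sub>F \<theta> in F. support_function B1 (cos \<theta>, sin \<theta>) \<le> cos \<theta> + \<bar>sin \<theta>\<bar> / sqrt pi"
    using assms(3) by eventually_elim (rule support_function_B1_squeeze)
  show "((\<lambda>\<theta>. \<bar>sin \<theta>\<bar> / sqrt pi) \<longlongrightarrow> 1 / sqrt pi) F"
    by (intro tendsto_divide assms) auto
  show "((\<lambda>\<theta>. cos \<theta> + \<bar>sin \<theta>\<bar> / sqrt pi) \<longlongrightarrow> 1 / sqrt pi) F"
    using tendsto_add[OF assms(2) tendsto_divide[OF assms(1) tendsto_const[of "sqrt pi"]]] by simp
qed

theorem lemma4p2:
  fixes h :: "real \<times> real \<Rightarrow> real"
  defines "h \<equiv> support_function B1"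
  shows "(\<forall>\<theta>::real. - pi / 2 < \<theta> \<and> \<theta> < pi / 2 \<longrightarrow>
            h (cos \<theta>, sin \<theta>) = cos \<theta> * exp ((inv G (tan \<theta>))\<^sup>2))
       \<and> h (0, 1) = 1 / sqrt pi
       \<and> ((\<lambda>\<theta>. h (cos \<theta>, sin \<theta>)) \<longlongrightarrow> 1 / sqrt pi) (at_left (pi / 2))
       \<and> h (0, -1) = 1 / sqrt pi
       \<and> ((\<lambda>\<theta>. h (cos \<theta>, sin \<theta>)) \<longlongrightarrow> 1 / sqrt pi) (at_right (- pi / 2))"
proof (intro conjI allI impI)
  fix \<theta> :: real
  assume "- pi / 2 < \<theta> \<and> \<theta> < pi / 2"
  then have pos: "cos \<theta> > 0" by (intro cos_gt_zero_pi) auto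
  \<comment> \<open>This puts the direction in the form \<open>(c, c * G z)\<close> with
    \<open>c = cos \<theta>\<close> and \<open>z = inv G (tan \<theta>)\<close>.\<close>
  then have "sin \<theta> = cos \<theta> * G (inv G (tan \<theta>))"
    by (simp add: surj_f_inv_f[OF surj_G] tan_def)
  then show "h (cos \<theta>, sin \<theta>) = cos \<theta> * exp ((inv G (tan \<theta>))\<^sup>2)"
    unfolding h_def using support_function_B1(1)[OF pos] by metis
next
  show "h (0, 1) = 1 / sqrt pi" "h (0, -1) = 1 / sqrt pi"
    unfolding h_def by (rule support_function_B1_axis, simp)+
next
  have "\<forall>\<^sub>F \<theta> in at_left (pi / 2). cos \<theta> > 0"
    unfolding eventually_at_left_field by (intro exI[of _ 0]) (auto intro!: cos_gt_zero)
  then show "((\<lambda>\<theta>. h (cos \<theta>, sin \<theta>)) \<longlongrightarrow> 1 / sqrt pi) (at_left (pi / 2))"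
    unfolding h_def by (intro tendsto_support_function_B1) (auto intro!: tendsto_eq_intros)
next
  have "\<forall>\<^sub>F \<theta> in at_right (- pi / 2). cos \<theta> > 0"
    unfolding eventually_at_right_field by (intro exI[of _ 0]) (auto intro!: cos_gt_zero_pi)
  then show "((\<lambda>\<theta>. h (cos \<theta>, sin \<theta>)) \<longlongrightarrow> 1 / sqrt pi) (at_right (- pi / 2))"
    unfolding h_def by (intro tendsto_support_function_B1) (auto intro!: tendsto_eq_intros)
qed

end
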